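(* Let $H$ be a complex, separable, infinite dimensional Hilbert space and let $T\in L(H)$ be such that $0\in\rho_\ell(T)$. Then $$\mathrm{dist}(0,\sigma_\ell(T))=\sup\left\{\frac{1}{r_\sigma(S)} : S\in L(H),\ ST=I\right\},$$ where $r_\sigma(S)$ is the spectral radius of $S$.
   Context: $L(H)$ is the algebra of all continuous linear operators on $H$ and $I$ is the identity operator. The left resolvent set $\rho_\ell(T)$ is the set of all $\lambda\in\mathbb{C}$ such that $\lambda I-T$ is left invertible in $L(H)$ (equivalently, one-to-one with closed range), and the left spectrum is $\sigma_\ell(T)=\mathbb{C}\setminus\rho_\ell(T)$. Here $\mathrm{dist}(0,\sigma_\ell(T))=\inf\{|\lambda|:\lambda\in\sigma_\ell(T)\}$. The convention $1/0=+\infty$ is used. *)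

theory Defs
  imports "HOL-Analysis.Analysis"
begin

section \<open>Complex Hilbert spaces\<close>

class complex_vector = real_vector +
  fixes scaleC :: "complex \<Rightarrow> 'a \<Rightarrow> 'a"  (infixr \<open>*\<^sub>C\<close> 75)
  assumes scaleC_add_right: "a *\<^sub>C (x + y) = a *\<^sub>C x + a *\<^sub>C y"
    and scaleC_add_left: "(a + b) *\<^sub>C x = a *\<^sub>C x + b *\<^sub>C x"
    and scaleC_scaleC: "a *\<^sub>C b *\<^sub>C x = (a * b) *\<^sub>C x"
    and scaleC_one: "1 *\<^sub>C x = x"
    and scaleR_scaleC: "r *\<^sub>R x = complex_of_real r *\<^sub>C x"

global_interpretation complex_vector: vector_space "scaleC :: complex \<Rightarrow> 'a \<Rightarrow> 'a::complex_vector"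
  by unfold_locales (simp_all add: scaleC_add_right scaleC_add_left scaleC_scaleC scaleC_one)

text \<open>
  The Hermitian inner product is linear in its first argument. Its real part is the inner product
  of the underlying real inner product space, so that the norm and the topology are the ones
  induced by \<open>cinner\<close>; see \<open>cinner_self\<close> below, which also shows positive definiteness.
\<close>

class complex_inner = complex_vector + real_inner +
  fixes cinner :: "'a \<Rightarrow> 'a \<Rightarrow> complex"
  assumes cinner_commute: "cinner x y = cnj (cinner y x)"
    and cinner_add_left: "cinner (x + y) z = cinner x z + cinner y z"
    and cinner_scaleC_left: "cinner (a *\<^sub>C x) y = a * cinner x y"
    and Re_cinner: "Re (cinner x y) = inner x y"

lemma cinner_self: "cinner x x = complex_of_real ((norm x)\<^sup>2)"
proof -
  have "cinner x x = cnj (cinner x x)"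
    by (rule cinner_commute)
  then have "Im (cinner x x) = 0"
    by (metis cnj.simps(2) equal_neg_zero)
  then show ?thesis
    by (simp add: complex_eq_iff Re_cinner power2_norm_eq_inner)
qed

class chilbert_space = complex_inner + complete_space

section \<open>Operators and spectra\<close>

definition bounded_operators :: "('a::complex_inner \<Rightarrow> 'a) set"
  where "bounded_operators = {f. Vector_Spaces.linear (*\<^sub>C) (*\<^sub>C) f \<and> continuous_on UNIV f}"

definition left_invertible :: "('a::complex_inner \<Rightarrow> 'a) \<Rightarrow> bool"
  where "left_invertible A \<longleftrightarrow> (\<exists>S \<in> bounded_operators. S \<circ> A = id)"

definition left_resolvent_set :: "('a::complex_inner \<Rightarrow> 'a) \<Rightarrow> complex set"
  where "left_resolvent_set T = {l. left_invertible (\<lambda>x. l *\<^sub>C x - T x)}"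

definition left_spectrum :: "('a::complex_inner \<Rightarrow> 'a) \<Rightarrow> complex set"
  where "left_spectrum T = UNIV - left_resolvent_set T"

definition spectrum :: "('a::complex_inner \<Rightarrow> 'a) \<Rightarrow> complex set"
  where "spectrum S =
    {l. \<not> (\<exists>R \<in> bounded_operators. R \<circ> (\<lambda>x. l *\<^sub>C x - S x) = id \<and> (\<lambda>x. l *\<^sub>C x - S x) \<circ> R = id)}"

definition spectral_radius :: "('a::complex_inner \<Rightarrow> 'a) \<Rightarrow> real"
  where "spectral_radius S = (SUP l \<in> spectrum S. cmod l)"

text \<open>Reciprocals of spectral radii are taken in \<^typ>\<open>ereal\<close>, where \<open>1 / 0\<close> is \<open>\<infinity>\<close>.\<close>

lemma one_divide_ereal_zero: "1 / ereal 0 = \<infinity>"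
  by (simp add: divide_ereal_def)

end

theory Submission
  imports Defs
begin

text \<open>
  If \<open>S\<close> is a left inverse of \<open>T\<close> and \<open>1 / l\<close> is outside the spectrum of \<open>S\<close>, then
  \<open>S (l I - T) = l S - I = - l (1 / l I - S)\<close> is invertible, so \<open>l\<close> is in the left resolvent set
  (\<open>inverse_in_spectrum_left_inverse\<close>). Hence \<open>1 / r(S)\<close> never exceeds the distance from \<open>0\<close> to the
  left spectrum.

  Conversely, let the closed disc of radius \<open>r\<close> lie in the left resolvent set. By compactness,
  \<open>l I - T\<close> is bounded below by one constant for all \<open>l\<close> in the disc. The heart of the proof is
  that this makes \<open>T ^^ n\<close> expand by at least \<open>r ^ n\<close> for some \<open>n > 0\<close>
  (\<open>funpow_expansive_if_cball_subset_left_resolvent_set\<close>). Averaging the identity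
  \<open>(l I - T) (\<Sum>k<n. l ^ k T ^ (n - 1 - k) x) = l ^ n x - T ^ n x\<close> over the points
  \<open>l = s w\<close>, with \<open>w\<close> running through the \<open>n\<close>-th roots of unity, Parseval's identity shows that the
  numbers \<open>a k = (norm (T ^ k x) / s ^ k)\<^sup>2\<close> satisfy \<open>d (a 0 + \<dots> + a (n - 1)) \<le> a n + a 0\<close>, where
  \<open>d\<close> depends only on the disc. A sequence that dominates its partial sums in this way and does not
  decay must grow exponentially. So if the orbits of \<open>T\<close> grow at rate \<open>s \<le> r\<close>, they even grow at rate
  \<open>q s\<close>, with a factor \<open>q > 1\<close> that is the same for all \<open>s \<le> r\<close>; finitely many improvements,
  starting from the lower bound of \<open>T\<close>, lead beyond \<open>r\<close>.

  Once \<open>norm (T ^ n x) \<ge> r ^ n norm x\<close>, the equivalent inner product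
  \<open>\<Sum>k<n. \<langle>T ^ k x, T ^ k y\<rangle> / r ^ (2 k)\<close> makes \<open>T\<close> itself expand by the factor \<open>r\<close>. The orthogonal
  projection onto the range of \<open>T\<close>, followed by the inverse of \<open>T\<close>, is then a left inverse whose norm in
  the new inner product is at most \<open>1 / r\<close>, and so is its spectral radius
  (\<open>left_inverse_if_funpow_expansive\<close>).

  The growth of the orbits also shows that the left spectrum is nonempty, since no rate above the norm
  of \<open>T\<close> is possible. Thus the left inverses have nonempty spectra and positive spectral radii.
\<close>

section \<open>Operators on complex inner product spaces\<close>

instance chilbert_space \<subseteq> banach ..

lemma norm_scaleC: "norm (c *\<^sub>C x) = cmod c * norm (x :: 'a::complex_inner)"
proof -
  have "complex_of_real ((norm (c *\<^sub>C x))\<^sup>2) = c * (cnj c * cinner x x)"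
    by (subst cinner_self[symmetric], simp only: cinner_scaleC_left,
        subst cinner_commute, simp only: cinner_scaleC_left complex_cnj_mult cinner_commute[of x x, symmetric])
  also have "\<dots> = (c * cnj c) * cinner x x"
    by (simp only: mult.assoc)
  also have "\<dots> = complex_of_real ((cmod c * norm x)\<^sup>2)"
    by (simp only: cinner_self power_mult_distrib complex_norm_square[symmetric] of_real_mult)
  finally have "(norm (c *\<^sub>C x))\<^sup>2 = (cmod c * norm x)\<^sup>2"
    by (simp only: of_real_eq_iff)
  then show ?thesis by (simp add: power2_eq_iff_nonneg)
qed

lemma inner_scaleC_left: "inner (c *\<^sub>C x) y = inner x (cnj c *\<^sub>C (y :: 'a::complex_inner))"
proof -
  have "cinner (c *\<^sub>C x) y = cinner x (cnj c *\<^sub>C y)"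
    by (metis cinner_commute cinner_scaleC_left complex_cnj_cnj complex_cnj_mult)
  then show ?thesis by (simp flip: Re_cinner)
qed

lemma bounded_linear_scaleC: "bounded_linear (\<lambda>x :: 'a::complex_inner. c *\<^sub>C x)"
proof (rule bounded_linear_intro)
  show "norm (c *\<^sub>C x) \<le> norm x * cmod c" for x :: 'a by (simp add: norm_scaleC)
qed (simp_all add: scaleC_add_right scaleR_scaleC scaleC_scaleC mult.commute)

lemma bounded_operators_iff:
  "f \<in> bounded_operators \<longleftrightarrow> bounded_linear f \<and> (\<forall>c x. f (c *\<^sub>C x) = c *\<^sub>C f x)"
proof
  assume "f \<in> bounded_operators"
  then have lin: "Vector_Spaces.linear (*\<^sub>C) (*\<^sub>C) f" and cont: "continuous_on UNIV f"
    by (auto simp: bounded_operators_def)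
  interpret Vector_Spaces.linear "(*\<^sub>C)" "(*\<^sub>C)" f by (rule lin)
  obtain d where d: "d > 0" "\<And>x. norm x < d \<Longrightarrow> norm (f x) < 1"
    using cont unfolding continuous_on_iff
    by (metis UNIV_I dist_0_norm dist_commute zero zero_less_one)
  have "norm (f x) \<le> norm x * (2 / d)" for x
  proof (cases "x = 0")
    case False
    define t where "t = d / (2 * norm x)"
    have t: "t > 0" using d False by (simp add: t_def)
    have "norm (t *\<^sub>R x) < d" using d False by (simp add: t_def)
    then have "norm (f (t *\<^sub>R x)) < 1" by (rule d(2))
    then have "t * norm (f x) < 1"
      using t by (simp add: scaleR_scaleC scale norm_scaleC)
    then show ?thesis
      using d False by (simp add: t_def field_simps)
  qed (simp add: zero)
  then have "bounded_linear f"
    by (intro bounded_linear_intro[of f "2 / d"]) (simp_all add: add scaleR_scaleC scale)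
  then show "bounded_linear f \<and> (\<forall>c x. f (c *\<^sub>C x) = c *\<^sub>C f x)"
    by (simp add: scale)
next
  assume f: "bounded_linear f \<and> (\<forall>c x. f (c *\<^sub>C x) = c *\<^sub>C f x)"
  then have "Vector_Spaces.linear (*\<^sub>C) (*\<^sub>C) f"
    by unfold_locales (auto simp: linear_simps)
  then show "f \<in> bounded_operators"
    using f by (auto simp: bounded_operators_def intro: linear_continuous_on)
qed

lemma bounded_operators_comp:
  "f \<in> bounded_operators \<Longrightarrow> g \<in> bounded_operators \<Longrightarrow> f \<circ> g \<in> bounded_operators"
  by (auto simp: bounded_operators_iff o_def intro: bounded_linear_compose)

lemma bounded_operators_scaleC_comp:
  "f \<in> bounded_operators \<Longrightarrow> (\<lambda>x. c *\<^sub>C f x) \<in> bounded_operators"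
  by (auto simp: bounded_operators_iff scaleC_scaleC mult.commute
      intro: bounded_linear_compose[OF bounded_linear_scaleC])

lemma bounded_operators_funpow:
  "f \<in> bounded_operators \<Longrightarrow> f ^^ k \<in> bounded_operators"
proof (induction k)
  case 0
  then show ?case by (auto simp: bounded_operators_iff id_def)
next
  case (Suc k)
  then show ?case by (simp only: funpow.simps bounded_operators_comp)
qed

section \<open>Spectra of left inverses\<close>

text \<open>
  The Neumann series \<open>\<Sum>k. S ^ k / l ^ (k + 1)\<close> converges and inverts \<open>l I - S\<close>. Allowing the constant
  \<open>M\<close> makes the criterion applicable to operators that are contractive only for an equivalent norm.
\<close>

lemma notin_spectrum_if_funpow_bound:
  fixes S :: "'a::chilbert_space \<Rightarrow> 'a"
  assumes S: "S \<in> bounded_operators"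
    and bound: "\<And>k x. norm ((S ^^ k) x) \<le> M * q ^ k * norm x"
    and q: "0 \<le> q" "q < cmod l"
  shows "l \<notin> spectrum S"
proof -
  have l: "l \<noteq> 0" using q by auto
  have S': "bounded_linear S" "\<And>c x. S (c *\<^sub>C x) = c *\<^sub>C S x"
    using S by (auto simp: bounded_operators_iff)
  have P: "bounded_linear (S ^^ k)" "(S ^^ k) (c *\<^sub>C x) = c *\<^sub>C (S ^^ k) x" for k c x
    using bounded_operators_funpow[OF S] by (auto simp: bounded_operators_iff)
  define u where "u y k = (1 / l) ^ Suc k *\<^sub>C (S ^^ k) y" for y k
  define R where "R y = (\<Sum>k. u y k)" for y
  define p where "p = q / cmod l"
  have p: "0 \<le> p" "p < 1" using q l by (auto simp: p_def field_simps)
  have u_le: "norm (u y k) \<le> (M * norm y / cmod l) * p ^ k" for y k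
  proof -
    have "norm (u y k) = norm ((S ^^ k) y) / cmod l ^ Suc k"
      by (simp add: u_def norm_scaleC norm_divide norm_power field_simps norm_mult)
    also have "\<dots> \<le> (M * q ^ k * norm y) / cmod l ^ Suc k"
      using bound by (intro divide_right_mono) auto
    finally show ?thesis by (simp add: p_def power_divide field_simps)
  qed
  have geo: "summable (\<lambda>k. (M * norm y / cmod l) * p ^ k)" for y :: 'a
    using p by (intro summable_mult summable_geometric) auto
  have sums: "summable (u y)" for y
    by (rule summable_comparison_test'[OF geo u_le])
  have R_le: "norm (R y) \<le> norm y * (M / cmod l * (1 / (1 - p)))" for y
  proof -
    have "norm (R y) \<le> (\<Sum>k. (M * norm y / cmod l) * p ^ k)"
      unfolding R_def by (rule norm_suminf_le[OF u_le geo])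
    also have "\<dots> = (M * norm y / cmod l) * (1 / (1 - p))"
      using p by (subst suminf_mult) (auto simp: suminf_geometric summable_geometric)
    finally show ?thesis by (simp add: mult_ac)
  qed
  have R_add: "R (x + y) = R x + R y" for x y
  proof -
    have "u (x + y) = (\<lambda>k. u x k + u y k)"
      by (simp add: u_def fun_eq_iff linear_simps[OF P(1)] scaleC_add_right)
    then show ?thesis by (simp add: R_def suminf_add[OF sums sums])
  qed
  have R_scaleC: "R (c *\<^sub>C y) = c *\<^sub>C R y" for c y
  proof -
    have "u (c *\<^sub>C y) = (\<lambda>k. c *\<^sub>C u y k)"
      by (simp add: u_def fun_eq_iff P(2) scaleC_scaleC mult.commute)
    then show ?thesis by (simp add: R_def bounded_linear.suminf[OF bounded_linear_scaleC sums])
  qed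
  have "bounded_linear R"
    by (rule bounded_linear_intro[OF R_add _ R_le]) (simp add: scaleR_scaleC R_scaleC)
  then have R: "R \<in> bounded_operators"
    by (simp add: bounded_operators_iff R_scaleC)
  have SR: "S (R y) = R (S y)" for y
  proof -
    have "u (S y) = (\<lambda>k. S (u y k))"
      by (simp add: u_def fun_eq_iff S'(2) funpow_swap1)
    then show ?thesis by (simp add: R_def bounded_linear.suminf[OF S'(1) sums])
  qed
  have right: "l *\<^sub>C R y - S (R y) = y" for y
  proof -
    have "l *\<^sub>C R y = (\<Sum>k. (1 / l) ^ k *\<^sub>C (S ^^ k) y)"
      unfolding R_def bounded_linear.suminf[OF bounded_linear_scaleC sums]
      using l by (simp add: u_def scaleC_scaleC)
    also have "\<dots> = y + (\<Sum>k. S (u y k))"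
    proof -
      have "summable (\<lambda>k. l *\<^sub>C u y k)"
        by (rule bounded_linear.summable[OF bounded_linear_scaleC sums])
      then have "summable (\<lambda>k. (1 / l) ^ k *\<^sub>C (S ^^ k) y)"
        using l by (simp add: u_def scaleC_scaleC)
      from suminf_split_head[OF this] show ?thesis
        by (simp add: u_def S'(2) scaleC_one)
    qed
    also have "(\<Sum>k. S (u y k)) = S (R y)"
      unfolding R_def by (rule bounded_linear.suminf[OF S'(1) sums, symmetric])
    finally show ?thesis by simp
  qed
  have left: "R (l *\<^sub>C y - S y) = y" for y
    using R right[of y] by (simp add: bounded_operators_iff linear_simps SR)
  show ?thesis
    unfolding spectrum_def using R left right by (auto simp: fun_eq_iff intro!: bexI[of _ R])
qed

lemma funpow_le_onorm:
  fixes f :: "'a::real_normed_vector \<Rightarrow> 'a"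
  assumes "bounded_linear f"
  shows "norm ((f ^^ k) x) \<le> onorm f ^ k * norm x"
proof (induction k)
  case (Suc k)
  have "norm (f ((f ^^ k) x)) \<le> onorm f * norm ((f ^^ k) x)" by (rule onorm[OF assms])
  also have "\<dots> \<le> onorm f * (onorm f ^ k * norm x)"
    by (intro mult_left_mono Suc onorm_pos_le assms)
  finally show ?case by (simp add: mult_ac)
qed simp

lemma bdd_above_spectrum:
  fixes S :: "'a::chilbert_space \<Rightarrow> 'a"
  assumes S: "S \<in> bounded_operators"
  shows "bdd_above (cmod ` spectrum S)"
proof (rule bdd_aboveI2)
  have bl: "bounded_linear S" using S by (simp add: bounded_operators_iff)
  show "cmod l \<le> onorm S" if "l \<in> spectrum S" for l
    using notin_spectrum_if_funpow_bound[OF S, of 1 "onorm S" l] funpow_le_onorm[OF bl] 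
      onorm_pos_le[OF bl] that by force
qed

text \<open>
  If \<open>R\<close> inverts \<open>1 / l I - S\<close>, then \<open>- 1 / l R S\<close> is a left inverse of \<open>l I - T\<close>, because
  \<open>S (l I - T) = - l (1 / l I - S)\<close>.
\<close>

lemma inverse_in_spectrum_left_inverse:
  fixes T :: "'a::chilbert_space \<Rightarrow> 'a"
  assumes S: "S \<in> bounded_operators" and ST: "S \<circ> T = id"
    and l: "l \<in> left_spectrum T" and l0: "l \<noteq> 0"
  shows "1 / l \<in> spectrum S"
proof (rule ccontr)
  assume "1 / l \<notin> spectrum S"
  then obtain R where R: "R \<in> bounded_operators" and inv: "\<And>x. R ((1 / l) *\<^sub>C x - S x) = x"
    unfolding spectrum_def by (auto simp: fun_eq_iff)
  define L where "L = (\<lambda>x. (- (1 / l)) *\<^sub>C (R \<circ> S) x)"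
  have "L \<in> bounded_operators"
    unfolding L_def by (intro bounded_operators_scaleC_comp bounded_operators_comp R S)
  moreover have "L (l *\<^sub>C x - T x) = x" for x
  proof -
    have "S (T x) = x" using ST by (simp add: fun_eq_iff)
    then have "S (l *\<^sub>C x - T x) = (- l) *\<^sub>C ((1 / l) *\<^sub>C x - S x)"
      using S l0 by (simp add: bounded_operators_iff linear_simps scaleC_scaleC
          complex_vector.scale_right_diff_distrib scaleC_one)
    then show ?thesis
      using R l0 by (simp add: L_def bounded_operators_iff inv scaleC_scaleC scaleC_one del: complex_vector.scale_minus_left)
  qed
  ultimately have "left_invertible (\<lambda>x. l *\<^sub>C x - T x)"
    by (auto simp: left_invertible_def fun_eq_iff intro!: bexI[of _ L])
  then show False using l by (simp add: left_spectrum_def left_resolvent_set_def)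
qed

section \<open>Growth of orbits\<close>

text \<open>
  A lower bound \<open>c m\<close> for \<open>m I - T\<close> leaves the lower bound \<open>c m / 2\<close> for \<open>l I - T\<close> as long as \<open>l\<close> has
  distance less than \<open>c m / 2\<close> from \<open>m\<close>; finitely many such balls cover \<open>K\<close>.
\<close>

lemma left_resolvent_lower_bound_compact:
  fixes T :: "'a::complex_inner \<Rightarrow> 'a"
  assumes K: "compact K" "K \<subseteq> left_resolvent_set T"
  obtains c where "c > 0" "\<And>l x. l \<in> K \<Longrightarrow> c * norm x \<le> norm (l *\<^sub>C x - T x)"
proof -
  have "\<exists>c>0. \<forall>x. c * norm x \<le> norm (l *\<^sub>C x - T x)" if "l \<in> K" for l
  proof -
    have "left_invertible (\<lambda>x. l *\<^sub>C x - T x)"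
      using K(2) that by (auto simp: left_resolvent_set_def)
    then obtain S where "S \<in> bounded_operators" and "S \<circ> (\<lambda>x. l *\<^sub>C x - T x) = id"
      unfolding left_invertible_def by blast
    then have S: "bounded_linear S" and inv: "\<And>x. S (l *\<^sub>C x - T x) = x"
      by (auto simp: bounded_operators_iff fun_eq_iff)
    obtain B where B: "B > 0" "\<And>x. norm (S x) \<le> norm x * B"
      using bounded_linear.pos_bounded[OF S] by blast
    have "(1 / B) * norm x \<le> norm (l *\<^sub>C x - T x)" for x
      using B(2)[of "l *\<^sub>C x - T x"] B(1) by (simp add: inv field_simps)
    then show ?thesis using B(1) by (intro exI[of _ "1 / B"]) auto
  qed
  then obtain c where c: "\<And>l. l \<in> K \<Longrightarrow> c l > 0"
    "\<And>l x. l \<in> K \<Longrightarrow> c l * norm x \<le> norm (l *\<^sub>C x - T x)"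
    by metis
  obtain D where D: "D \<subseteq> K" "finite D" "K \<subseteq> (\<Union>m\<in>D. ball m (c m / 2))"
    by (rule compactE_image[OF K(1), of K "\<lambda>m. ball m (c m / 2)"]) (use c(1) in force)+
  define d where "d = Min (insert 1 ((\<lambda>m. c m / 2) ` D))"
  have "d > 0" using D c(1) by (auto simp: d_def)
  moreover have "d * norm x \<le> norm (l *\<^sub>C x - T x)" if "l \<in> K" for l x
  proof -
    have "l \<in> (\<Union>m\<in>D. ball m (c m / 2))" using D(3) that by blast
    then obtain m where m: "m \<in> D" "dist m l < c m / 2" by auto
    have "m *\<^sub>C x - T x = (l *\<^sub>C x - T x) + (m - l) *\<^sub>C x"
      by (simp add: complex_vector.scale_left_diff_distrib)
    then have "norm (m *\<^sub>C x - T x) \<le> norm (l *\<^sub>C x - T x) + dist m l * norm x"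
      by (metis norm_triangle_ineq norm_scaleC dist_norm)
    moreover have "c m * norm x \<le> norm (m *\<^sub>C x - T x)" using c(2) m D by blast
    moreover have "dist m l * norm x \<le> (c m / 2) * norm x"
      using m by (intro mult_right_mono) auto
    moreover have "d \<le> c m / 2"
      unfolding d_def using m D(2) by (intro Min_le) auto
    then have "d * norm x \<le> (c m / 2) * norm x" by (rule mult_right_mono) simp
    ultimately show ?thesis by linarith
  qed
  ultimately show ?thesis by (rule that)
qed

lemma sum_roots_of_unity_orthogonal:
  assumes "k < n" "l < n"
  shows "(\<Sum>j<n. cnj (cis (2 * pi * real j / real n) ^ l) * cis (2 * pi * real j / real n) ^ k)
    = (if k = l then of_nat n else 0)"
proof -
  define w where "w j = cis (2 * pi * real j / real n)" for j
  define z where "z = cnj (w l) * w k"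
  \<comment> \<open>This symmetry turns the sum over the roots of unity into a geometric sum with ratio \<open>z\<close>.\<close>
  have swap: "w j ^ i = w i ^ j" for i j
    unfolding w_def Complex.DeMoivre by (rule arg_cong[of _ _ cis]) simp
  have cnj_w: "cnj (w i) * w i = 1" for i
    by (simp add: w_def cis_cnj cis_mult)
  have "w i ^ n = 1" for i
    using assms by (simp add: w_def Complex.DeMoivre)
  then have zn: "z ^ n = 1"
    by (simp add: z_def power_mult_distrib flip: complex_cnj_power)
  have "(\<Sum>j<n. cnj (w j ^ l) * w j ^ k) = (\<Sum>j<n. z ^ j)"
    by (simp add: z_def power_mult_distrib swap[of _ l] swap[of _ k])
  also have "\<dots> = (if k = l then of_nat n else 0)"
  proof (cases "k = l")
    case True
    then show ?thesis by (simp add: z_def cnj_w)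
  next
    case False
    have "inj_on w {..<n}"
      using Complex.bij_betw_roots_unity[of n] assms by (auto simp: bij_betw_def w_def [abs_def])
    then have "w k \<noteq> w l" using False assms by (auto dest: inj_onD)
    then have "z \<noteq> 1"
      using cnj_w[of l] by (auto simp: z_def) (metis mult_cancel_left mult_eq_0_iff zero_neq_one)
    moreover have "(1 - z) * (\<Sum>j<n. z ^ j) = 0"
      using one_diff_power_eq[of z n] zn by simp
    ultimately show ?thesis using False by simp
  qed
  finally show ?thesis by (simp add: w_def)
qed

lemma parseval_roots_of_unity:
  fixes v :: "nat \<Rightarrow> 'a::complex_inner"
  shows "(\<Sum>j<n. (norm (\<Sum>k<n. cis (2 * pi * real j / real n) ^ k *\<^sub>C v k))\<^sup>2)
    = real n * (\<Sum>k<n. (norm (v k))\<^sup>2)"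
proof -
  define w where "w j = cis (2 * pi * real j / real n)" for j
  have orth: "(\<Sum>j<n. cnj (w j ^ l) * w j ^ k) = (if k = l then of_nat n else 0)"
    if "k < n" "l < n" for k l
    using sum_roots_of_unity_orthogonal[OF that] by (simp add: w_def)
  have of_nat_scaleC: "of_nat m *\<^sub>C x = real m *\<^sub>R x" for m and x :: 'a
    by (simp add: scaleR_scaleC)
  have swap: "inner x (c *\<^sub>C y) = inner (cnj c *\<^sub>C x) y" for c and x y :: 'a
    by (simp add: inner_scaleC_left)
  have "(\<Sum>j<n. (norm (\<Sum>k<n. w j ^ k *\<^sub>C v k))\<^sup>2)
    = (\<Sum>j<n. \<Sum>k<n. \<Sum>l<n. inner ((cnj (w j ^ l) * w j ^ k) *\<^sub>C v k) (v l))"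
    by (simp only: power2_norm_eq_inner inner_sum_left inner_sum_right swap scaleC_scaleC
        complex_vector.scale_sum_right)
      (rule sum.cong[OF refl sum.swap])
  also have "\<dots> = (\<Sum>k<n. \<Sum>l<n. \<Sum>j<n. inner ((cnj (w j ^ l) * w j ^ k) *\<^sub>C v k) (v l))"
    by (rule trans[OF sum.swap sum.cong[OF refl sum.swap]])
  also have "\<dots> = (\<Sum>k<n. \<Sum>l<n. inner ((\<Sum>j<n. cnj (w j ^ l) * w j ^ k) *\<^sub>C v k) (v l))"
    by (simp add: complex_vector.scale_sum_left inner_sum_left)
  also have "\<dots> = (\<Sum>k<n. \<Sum>l<n. if l = k then real n * (norm (v k))\<^sup>2 else 0)"
    by (intro sum.cong refl) (auto simp: orth power2_norm_eq_inner of_nat_scaleC simp del: complex_cnj_power)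
  also have "\<dots> = real n * (\<Sum>k<n. (norm (v k))\<^sup>2)"
    by (simp add: sum_distrib_left)
  finally show ?thesis by (simp add: w_def)
qed

text \<open>
  The polynomial \<open>f l = \<Sum>k<n. l ^ k T ^ (n - 1 - k) x\<close> telescopes under \<open>l I - T\<close> to
  \<open>l ^ n x - T ^ n x\<close>. On the circle of radius \<open>s\<close> the latter has squared norm at most
  \<open>2 (s ^ (2 n) (norm x)\<^sup>2 + (norm (T ^ n x))\<^sup>2)\<close>, while the mean of the squared norm of \<open>f\<close> over \<open>s\<close> times
  the \<open>n\<close>-th roots of unity is the sum of the squared norms of the coefficients. The factor on the
  left is stated with \<open>r\<close> in place of \<open>s\<close> so that it does not depend on \<open>s\<close>.
\<close>

lemma orbit_sum_le:
  fixes T :: "'a::complex_inner \<Rightarrow> 'a"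
  assumes T: "T \<in> bounded_operators" and c: "c \<ge> 0"
    and s: "0 < s" "s \<le> r"
    and low: "\<And>l x. cmod l = s \<Longrightarrow> c * norm x \<le> norm (l *\<^sub>C x - T x)"
  shows "c\<^sup>2 / (2 * r\<^sup>2) * (\<Sum>k<n. (norm ((T ^^ k) x) / s ^ k)\<^sup>2)
    \<le> (norm ((T ^^ n) x) / s ^ n)\<^sup>2 + (norm x)\<^sup>2"
proof (cases "n = 0")
  case False
  define w where "w j = cis (2 * pi * real j / real n)" for j
  define a where "a k = (norm ((T ^^ k) x) / s ^ k)\<^sup>2" for k
  define v where "v k = of_real s ^ k *\<^sub>C (T ^^ (n - 1 - k)) x" for k
  define f where "f l = (\<Sum>k<n. l ^ k *\<^sub>C (T ^^ (n - 1 - k)) x)" for l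
  have lin: "bounded_linear T" and Tc: "\<And>c x. T (c *\<^sub>C x) = c *\<^sub>C T x"
    using T by (auto simp: bounded_operators_iff)
  have tele: "l *\<^sub>C f l - T (f l) = l ^ n *\<^sub>C x - (T ^^ n) x" for l
  proof -
    define g where "g k = l ^ k *\<^sub>C (T ^^ (n - k)) x" for k
    have "T ((T ^^ (n - 1 - k)) x) = (T ^^ (n - k)) x" if "k < n" for k
      using that by (metis Suc_diff_Suc comp_apply diff_Suc_eq_diff_pred funpow.simps(2))
    then have "l *\<^sub>C f l - T (f l) = (\<Sum>k<n. g (Suc k) - g k)"
      by (simp add: f_def g_def complex_vector.scale_sum_right linear_sum[OF bounded_linear.linear[OF lin]]
          Tc scaleC_scaleC sum_subtractf)
    also have "\<dots> = g n - g 0" by (rule sum_lessThan_telescope)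
    finally show ?thesis by (simp add: g_def scaleC_one)
  qed
  have fv: "f (of_real s * w j) = (\<Sum>k<n. w j ^ k *\<^sub>C v k)" for j
    by (simp add: f_def v_def scaleC_scaleC power_mult_distrib mult.commute)
  have bound: "c\<^sup>2 * (norm (f (of_real s * w j)))\<^sup>2 \<le> 2 * s ^ (2 * n) * (a n + (norm x)\<^sup>2)" for j
  proof -
    define l where "l = of_real s * w j"
    have l: "cmod l = s" using s by (simp add: l_def w_def norm_mult)
    have "c * norm (f l) \<le> norm (l ^ n *\<^sub>C x - (T ^^ n) x)"
      using low[OF l, of "f l"] by (simp add: tele)
    also have "\<dots> \<le> s ^ n * norm x + norm ((T ^^ n) x)"
      by (rule order_trans[OF norm_triangle_ineq4]) (simp add: norm_scaleC norm_power l)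
    finally have "(c * norm (f l))\<^sup>2 \<le> (s ^ n * norm x + norm ((T ^^ n) x))\<^sup>2"
      using c by (intro power_mono) auto
    also have "\<dots> \<le> 2 * ((s ^ n * norm x)\<^sup>2 + (norm ((T ^^ n) x))\<^sup>2)"
      using zero_le_power2[of "s ^ n * norm x - norm ((T ^^ n) x)"]
      by (simp add: power2_eq_square algebra_simps)
    also have "\<dots> = 2 * s ^ (2 * n) * (a n + (norm x)\<^sup>2)"
      using s by (simp add: a_def power_mult_distrib power_divide field_simps flip: power_mult)
    finally show ?thesis by (simp add: power_mult_distrib l_def)
  qed
  have v_a: "(norm (v k))\<^sup>2 = s ^ (2 * (n - 1)) * a (n - 1 - k)" if "k < n" for k
  proof -
    have "s ^ (n - 1) = s ^ k * s ^ (n - 1 - k)"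
      using that by (simp flip: power_add)
    then have "norm (v k) = s ^ (n - 1) * (norm ((T ^^ (n - 1 - k)) x) / s ^ (n - 1 - k))"
      using s by (simp add: v_def norm_scaleC norm_power)
    then show ?thesis
      by (simp only: a_def power_mult_distrib power_even_eq)
  qed
  have "(\<Sum>k<n. (norm (v k))\<^sup>2) = (\<Sum>k<n. s ^ (2 * (n - 1)) * a (n - Suc k))"
    by (intro sum.cong refl) (simp add: v_a)
  also have "\<dots> = s ^ (2 * (n - 1)) * (\<Sum>k<n. a k)"
    by (simp add: sum.nat_diff_reindex flip: sum_distrib_left)
  finally have sum_v: "(\<Sum>k<n. (norm (v k))\<^sup>2) = s ^ (2 * (n - 1)) * (\<Sum>k<n. a k)" .
  have parseval: "(\<Sum>j<n. (norm (f (of_real s * w j)))\<^sup>2) = real n * (\<Sum>k<n. (norm (v k))\<^sup>2)"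
    unfolding fv unfolding w_def by (rule parseval_roots_of_unity)
  have "real n * (c\<^sup>2 * s ^ (2 * (n - 1)) * (\<Sum>k<n. a k))
      = (\<Sum>j<n. c\<^sup>2 * (norm (f (of_real s * w j)))\<^sup>2)"
    by (simp only: sum_distrib_left[symmetric] parseval sum_v mult_ac)
  also have "\<dots> \<le> (\<Sum>j<n. 2 * s ^ (2 * n) * (a n + (norm x)\<^sup>2))"
    by (intro sum_mono bound)
  finally have "c\<^sup>2 * s ^ (2 * (n - 1)) * (\<Sum>k<n. a k) \<le> 2 * s ^ (2 * n) * (a n + (norm x)\<^sup>2)"
    using False by simp
  also have "s ^ (2 * n) = s ^ (2 * (n - 1)) * s\<^sup>2"
    using False by (cases n) (simp_all add: power2_eq_square)
  finally have "s ^ (2 * (n - 1)) * (c\<^sup>2 * (\<Sum>k<n. a k)) \<le> s ^ (2 * (n - 1)) * (2 * s\<^sup>2 * (a n + (norm x)\<^sup>2))"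
    by (simp add: mult_ac)
  then have "c\<^sup>2 * (\<Sum>k<n. a k) \<le> 2 * s\<^sup>2 * (a n + (norm x)\<^sup>2)"
    using s by (simp add: mult_le_cancel_left_pos)
  also have "\<dots> \<le> 2 * r\<^sup>2 * (a n + (norm x)\<^sup>2)"
    using s by (intro mult_right_mono mult_left_mono power_mono) (auto simp: a_def)
  finally show ?thesis
    using s by (simp add: a_def field_simps)
qed simp

text \<open>
  The partial sums \<open>A n\<close> satisfy \<open>A (n + 1) \<ge> (1 + d) A n - b\<close>. After \<open>m\<close> steps the lower bound
  \<open>e b\<close> on the terms has made \<open>A n\<close> so large that \<open>b \<le> d / 2 A n\<close>; from then on \<open>A\<close>, and with it \<open>a\<close>,
  grows by the factor \<open>1 + d / 2\<close>. The number \<open>m\<close> depends on \<open>d\<close> and \<open>e\<close> only, so that the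
  resulting bound is uniform in the sequence.
\<close>

lemma exponential_growth_if_dominates_partial_sums:
  fixes a :: "nat \<Rightarrow> real"
  assumes d: "d > 0" and e: "0 < e" "e \<le> 1" and b: "b \<ge> 0"
    and low: "\<And>k. e * b \<le> a k"
    and dom: "\<And>n. d * (\<Sum>k<n. a k) \<le> a n + b"
    and m: "real m * (d * e) \<ge> 2"
  shows "e * (1 + d / 2) ^ n / (1 + d / 2) ^ m * b \<le> a n"
proof (cases "n < m")
  case True
  have "(1 + d / 2) ^ n / (1 + d / 2) ^ m \<le> 1"
    using True d by (auto simp: divide_le_eq intro!: power_increasing)
  then have "(1 + d / 2) ^ n / (1 + d / 2) ^ m * (e * b) \<le> 1 * (e * b)"
    using e b by (intro mult_right_mono) auto
  then show ?thesis using low[of n] by (simp add: mult_ac)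
next
  case False
  define A where "A n = (\<Sum>k<n. a k)" for n
  have lowA: "real n * (e * b) \<le> A n" for n
    using sum_mono[of "{..<n}" "\<lambda>_. e * b" a] low by (simp add: A_def)
  have half: "b \<le> d / 2 * A n" if "n \<ge> m" for n
  proof -
    have "2 * b \<le> real m * (d * e) * b" using m b by (intro mult_right_mono)
    also have "\<dots> \<le> real n * (d * e) * b"
      using that d e b by (intro mult_right_mono) auto
    also have "\<dots> \<le> d * A n"
      using mult_left_mono[OF lowA[of n], of d] d by (simp add: mult_ac)
    finally show ?thesis by simp
  qed
  have step: "d / 2 * A n \<le> a n" if "n \<ge> m" for n
    using dom[of n] half[OF that] by (simp add: A_def)
  have "(1 + d / 2) ^ i * A m \<le> A (m + i)" for i
  proof (induction i)
    case (Suc i)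
    have "(1 + d / 2) ^ Suc i * A m \<le> (1 + d / 2) * A (m + i)"
      using mult_left_mono[OF Suc, of "1 + d / 2"] d by (simp add: mult_ac)
    also have "\<dots> \<le> A (m + Suc i)"
      using step[of "m + i"] by (simp add: A_def algebra_simps)
    finally show ?case .
  qed simp
  from this[of "n - m"] have grow: "(1 + d / 2) ^ (n - m) * A m \<le> A n" using False by simp
  have "e * (1 + d / 2) ^ n / (1 + d / 2) ^ m * b = (1 + d / 2) ^ (n - m) * (e * b)"
    using False d by (simp add: power_diff)
  also have "\<dots> \<le> (1 + d / 2) ^ (n - m) * (d / 2 * A m)"
  proof (intro mult_left_mono)
    have "e * b \<le> b" using e b by (simp add: mult_left_le_one_le)
    then show "e * b \<le> d / 2 * A m" using half[of m] by simp
  qed (use d in auto)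
  also have "\<dots> \<le> d / 2 * A n"
    using mult_left_mono[OF grow, of "d / 2"] d by (simp add: mult_ac)
  also have "\<dots> \<le> a n" using step False by simp
  finally show ?thesis .
qed

definition orbit_growth :: "('a::real_normed_vector \<Rightarrow> 'a) \<Rightarrow> real \<Rightarrow> bool"
  where "orbit_growth T s \<longleftrightarrow> (\<exists>C>0. \<forall>k x. C * s ^ k * norm x \<le> norm ((T ^^ k) x))"

text \<open>
  The factor gained depends on \<open>c\<close> and \<open>r\<close> but not on \<open>s\<close>, nor on the constant in the assumed growth,
  so the lemma can be iterated as long as the rate stays below \<open>r\<close>.
\<close>

lemma orbit_growth_improve:
  fixes T :: "'a::complex_inner \<Rightarrow> 'a"
  assumes T: "T \<in> bounded_operators" and c: "c > 0"
    and s: "0 < s" "s \<le> r"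
    and low: "\<And>l x. cmod l = s \<Longrightarrow> c * norm x \<le> norm (l *\<^sub>C x - T x)"
    and growth: "orbit_growth T s"
  shows "orbit_growth T (sqrt (1 + c\<^sup>2 / (4 * r\<^sup>2)) * s)"
proof -
  obtain C0 where C0: "C0 > 0" "\<And>k x. C0 * s ^ k * norm x \<le> norm ((T ^^ k) x)"
    using growth by (auto simp: orbit_growth_def)
  \<comment> \<open>The squared constant serves as \<open>e \<le> 1\<close> in the growth lemma for sequences.\<close>
  define C where "C = min C0 1"
  have C: "0 < C" "C \<le> 1" "C * s ^ k * norm x \<le> norm ((T ^^ k) x)" for k x
  proof -
    have "C * s ^ k * norm x \<le> C0 * s ^ k * norm x"
      using s by (intro mult_right_mono) (auto simp: C_def)
    with C0(2)[of k x] show "C * s ^ k * norm x \<le> norm ((T ^^ k) x)" by linarith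
  qed (use C0 in \<open>auto simp: C_def\<close>)
  define d where "d = c\<^sup>2 / (2 * r\<^sup>2)"
  define q where "q = sqrt (1 + c\<^sup>2 / (4 * r\<^sup>2))"
  have d: "d > 0" using c s by (simp add: d_def)
  have q2: "1 + d / 2 = q\<^sup>2" and q: "q > 0"
    by (simp_all add: q_def d_def add_nonneg_nonneg add_pos_nonneg)
  obtain m :: nat where "2 / (d * C\<^sup>2) \<le> real m"
    using real_arch_simple by blast
  then have m: "real m * (d * C\<^sup>2) \<ge> 2" using d C by (simp add: field_simps)
  have "C / q ^ m * (q * s) ^ n * norm x \<le> norm ((T ^^ n) x)" for n x
  proof -
    have "C\<^sup>2 * (1 + d / 2) ^ n / (1 + d / 2) ^ m * (norm x)\<^sup>2 \<le> (norm ((T ^^ n) x) / s ^ n)\<^sup>2"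
    proof (rule exponential_growth_if_dominates_partial_sums[OF d _ _ _ _ _ m])
      show "C\<^sup>2 * (norm x)\<^sup>2 \<le> (norm ((T ^^ k) x) / s ^ k)\<^sup>2" for k
        unfolding power_mult_distrib[symmetric]
        using C s by (intro power_mono) (auto simp: field_simps)
      show "d * (\<Sum>k<n. (norm ((T ^^ k) x) / s ^ k)\<^sup>2)
          \<le> (norm ((T ^^ n) x) / s ^ n)\<^sup>2 + (norm x)\<^sup>2" for n
        unfolding d_def using c by (intro orbit_sum_le[OF T _ s low]) auto
    qed (use C in \<open>auto simp: power_le_one\<close>)
    also have "C\<^sup>2 * (1 + d / 2) ^ n / (1 + d / 2) ^ m * (norm x)\<^sup>2 = (C * q ^ n / q ^ m * norm x)\<^sup>2"
      by (simp add: q2 power_mult_distrib power_divide flip: power_mult) (simp add: mult.commute)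
    finally have "C * q ^ n / q ^ m * norm x \<le> norm ((T ^^ n) x) / s ^ n"
      by (rule power2_le_imp_le) (use s in auto)
    then show ?thesis using s q by (simp add: field_simps)
  qed
  moreover have "C / q ^ m > 0" using C q by simp
  ultimately show ?thesis unfolding orbit_growth_def q_def by blast
qed

text \<open>Giving up a little of the rate absorbs the constant.\<close>

lemma orbit_growth_imp_funpow_expansive:
  assumes "orbit_growth T s" "0 < r" "r < s"
  obtains n where "n > 0" "\<And>x. r ^ n * norm x \<le> norm ((T ^^ n) x)"
proof -
  obtain C where C: "C > 0" "\<And>k x. C * s ^ k * norm x \<le> norm ((T ^^ k) x)"
    using assms(1) by (auto simp: orbit_growth_def)
  obtain n where n: "1 / C < (s / r) ^ n"
    using real_arch_pow[of "s / r" "1 / C"] assms by auto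
  have "(s / r) ^ n \<le> (s / r) ^ Suc n"
    using assms by (intro power_increasing) auto
  with n have "1 / C < (s / r) ^ Suc n" by linarith
  then have "r ^ Suc n \<le> C * s ^ Suc n"
    using assms C by (simp add: power_divide field_simps)
  then have "r ^ Suc n * norm x \<le> C * s ^ Suc n * norm x" for x :: 'a
    by (intro mult_right_mono) auto
  then have "r ^ Suc n * norm x \<le> norm ((T ^^ Suc n) x)" for x
    using C(2)[of "Suc n" x] by (meson order_trans)
  then show ?thesis by (intro that[of "Suc n"]) auto
qed

lemma funpow_expansive_if_cball_subset_left_resolvent_set:
  fixes T :: "'a::complex_inner \<Rightarrow> 'a"
  assumes T: "T \<in> bounded_operators" and r: "r > 0"
    and sub: "cball 0 r \<subseteq> left_resolvent_set T"
  obtains n where "n > 0" "\<And>x. r ^ n * norm x \<le> norm ((T ^^ n) x)"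
proof -
  obtain c where c: "c > 0"
    and low: "\<And>l x. l \<in> cball 0 r \<Longrightarrow> c * norm x \<le> norm (l *\<^sub>C x - T x)"
    using left_resolvent_lower_bound_compact[OF compact_cball sub] by metis
  define q where "q = sqrt (1 + c\<^sup>2 / (4 * r\<^sup>2))"
  have q: "q > 1" using c r by (simp add: q_def)
  have low0: "c * norm x \<le> norm (T x)" for x
    using low[of 0 x] r by simp
  have "c ^ k * norm x \<le> norm ((T ^^ k) x)" for k x
  proof (induction k)
    case (Suc k)
    have "c ^ Suc k * norm x \<le> c * norm ((T ^^ k) x)"
      using mult_left_mono[OF Suc, of c] c by (simp add: mult_ac)
    also have "\<dots> \<le> norm ((T ^^ Suc k) x)" using low0 by simp
    finally show ?case .
  qed simp
  then have start: "orbit_growth T c"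
    unfolding orbit_growth_def by (intro exI[of _ 1]) auto
  have "orbit_growth T (q ^ j * c) \<or> (\<exists>s>r. orbit_growth T s)" for j
  proof (induction j)
    case (Suc j)
    show ?case
    proof (cases "(\<exists>s>r. orbit_growth T s) \<or> q ^ j * c > r")
      case False
      then have g: "orbit_growth T (q ^ j * c)" and le: "q ^ j * c \<le> r" using Suc by auto
      have "orbit_growth T (q * (q ^ j * c))"
        unfolding q_def
        by (rule orbit_growth_improve[OF T c _ le[unfolded q_def] low g[unfolded q_def]])
          (use q c le in \<open>auto simp: q_def\<close>)
      then show ?thesis by (simp add: mult_ac)
    qed (use Suc in auto)
  qed (simp add: start)
  moreover obtain j where "r / c < q ^ j" using real_arch_pow[OF q] by blast
  then have "r < q ^ j * c" using c by (simp add: field_simps)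
  ultimately obtain s where "s > r" "orbit_growth T s" by blast
  then show ?thesis using orbit_growth_imp_funpow_expansive r that by blast
qed

section \<open>Contractive left inverses\<close>

text \<open>
  The left inverse maps \<open>y\<close> to the unique minimiser \<open>x\<close> of \<open>b (T x - y) (T x - y)\<close>, so that \<open>T (S y)\<close>
  is the \<open>b\<close>-orthogonal projection of \<open>y\<close> onto the range of \<open>T\<close>. The form \<open>b\<close> is the real part of a
  Hermitian inner product; the assumption on \<open>scaleC\<close> is what makes real orthogonality to the range of
  \<open>T\<close> invariant under complex multiples, and hence \<open>S\<close> complex linear.
\<close>

lemma contractive_left_inverse:
  fixes T :: "'a::chilbert_space \<Rightarrow> 'a" and b :: "'a \<Rightarrow> 'a \<Rightarrow> real"
  assumes T: "T \<in> bounded_operators"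
    and b: "bounded_bilinear b" and sym: "\<And>x y. b x y = b y x"
    and b_scaleC: "\<And>c x y. b (c *\<^sub>C x) y = b x (cnj c *\<^sub>C y)"
    and b_ge: "\<And>x. (norm x)\<^sup>2 \<le> b x x"
    and r: "r > 0" and T_ge: "\<And>x. r\<^sup>2 * b x x \<le> b (T x) (T x)"
  obtains S where "S \<in> bounded_operators" "S \<circ> T = id" "\<And>y. r\<^sup>2 * b (S y) (S y) \<le> b y y"
proof -
  interpret b: bounded_bilinear b by (rule b)
  interpret T: bounded_linear T using T by (simp add: bounded_operators_iff)
  have T_scaleC: "T (c *\<^sub>C x) = c *\<^sub>C T x" for c x using T by (simp add: bounded_operators_iff)
  have b_nonneg: "0 \<le> b x x" for x
    using b_ge[of x] by (rule order_trans[OF zero_le_power2])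
  have T_ge_norm: "r\<^sup>2 * (norm x)\<^sup>2 \<le> b (T x) (T x)" for x
    using T_ge[of x] mult_left_mono[OF b_ge[of x], of "r\<^sup>2"] by simp
  have T_zero: "x = 0" if "b (T x) (T x) = 0" for x
  proof -
    have "r\<^sup>2 * (norm x)\<^sup>2 \<le> 0" using T_ge_norm[of x] that by simp
    then show ?thesis using r by (simp add: mult_le_0_iff power2_eq_square)
  qed
  have "\<exists>x. \<forall>z. b (T x - y) (T z) = 0" for y
  proof -
    define F where "F x = b (T x - y) (T x - y)" for x
    define d where "d = Inf (range F)"
    have bdd: "bdd_below (range F)" by (auto simp: F_def b_nonneg intro!: bdd_belowI[of _ 0])
    have d_le: "d \<le> F x" for x unfolding d_def by (rule cInf_lower[OF _ bdd]) auto
    have "\<exists>x. F x < d + 1 / real (Suc n)" for n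
      using cInf_lessD[of "range F" "d + 1 / real (Suc n)"] by (auto simp: d_def)
    then obtain X where X: "\<And>n. F (X n) < d + 1 / real (Suc n)" by metis
    have par: "b (T (x - x')) (T (x - x')) + 4 * F ((1/2) *\<^sub>R (x + x')) = 2 * F x + 2 * F x'" for x x'
    proof -
      have half: "T ((1/2) *\<^sub>R (x + x')) - y = (1/2) *\<^sub>R ((T x - y) + (T x' - y))"
        by (simp add: T.scaleR T.add algebra_simps flip: scaleR_add_left)
      have diff: "T (x - x') = (T x - y) - (T x' - y)" by (simp add: T.diff)
      show ?thesis
        unfolding F_def half diff
        by (simp only: b.scaleR_left b.scaleR_right b.add_left b.add_right b.diff_left b.diff_right
            sym[of y "T x"] sym[of y "T x'"] sym[of "T x'" "T x"])
          (simp add: field_simps)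
    qed
    \<comment> \<open>By the parallelogram law a minimising sequence is Cauchy after applying \<open>T\<close>, hence itself Cauchy.\<close>
    have "Cauchy X"
    proof (rule metric_CauchyI)
      fix e :: real assume e: "e > 0"
      obtain N where N: "4 / ((r * e)\<^sup>2) < real N" using reals_Archimedean2 by blast
      have N': "4 / real (Suc N) < (r * e)\<^sup>2"
      proof -
        have "4 < real N * (r * e)\<^sup>2" using N r e by (simp add: field_simps)
        also have "\<dots> \<le> real (Suc N) * (r * e)\<^sup>2" by (intro mult_right_mono) auto
        finally show ?thesis by (simp add: field_simps)
      qed
      have "dist (X m) (X n) < e" if mn: "m \<ge> N" "n \<ge> N" for m n
      proof -
        have small: "F (X k) < d + 1 / real (Suc N)" if "k \<ge> N" for k
        proof -
          have "1 / real (Suc k) \<le> 1 / real (Suc N)" using that by (intro divide_left_mono) auto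
          with X[of k] show ?thesis by linarith
        qed
        have "(r * dist (X m) (X n))\<^sup>2 \<le> b (T (X m - X n)) (T (X m - X n))"
          using T_ge_norm[of "X m - X n"] by (simp add: dist_norm power_mult_distrib)
        also have "\<dots> \<le> 4 / real (Suc N)"
          using par[of "X m" "X n"] small[OF mn(1)] small[OF mn(2)] d_le[of "(1/2) *\<^sub>R (X m + X n)"]
          by simp
        also have "\<dots> < (r * e)\<^sup>2" by (rule N')
        finally have "r * dist (X m) (X n) < r * e"
          by (rule power2_less_imp_less) (use r e in auto)
        then show ?thesis using r by simp
      qed
      then show "\<exists>M. \<forall>m\<ge>M. \<forall>n\<ge>M. dist (X m) (X n) < e" by blast
    qed
    then obtain x where x: "X \<longlonglongrightarrow> x" using Cauchy_convergent convergentD by blast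
    have "(\<lambda>n. F (X n)) \<longlonglongrightarrow> F x"
      unfolding F_def by (intro b.tendsto tendsto_intros T.tendsto x)
    moreover have "(\<lambda>n. d + 1 / real (Suc n)) \<longlonglongrightarrow> d + 0"
      by (intro tendsto_intros LIMSEQ_Suc[OF lim_1_over_n])
    ultimately have "F x \<le> d + 0"
      by (rule LIMSEQ_le) (use X less_imp_le in blast)
    then have min: "F x \<le> F x'" for x' using d_le[of x'] by simp
    have "b (T x - y) (T z) = 0" for z
    proof (cases "b (T z) (T z) = 0")
      case True
      then have "z = 0" by (rule T_zero)
      then show ?thesis by (simp add: T.zero b.zero_right)
    next
      case False
      \<comment> \<open>The minimiser of the quadratic polynomial \<open>t \<mapsto> F (x + t z)\<close>.\<close>
      define t where "t = - (b (T x - y) (T z) / b (T z) (T z))"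
      have "T (x + t *\<^sub>R z) - y = (T x - y) + t *\<^sub>R T z" by (simp add: T.add T.scaleR)
      then have "F (x + t *\<^sub>R z) = F x + 2 * t * b (T x - y) (T z) + t\<^sup>2 * b (T z) (T z)"
        unfolding F_def
        by (simp only: b.scaleR_left b.scaleR_right b.add_left b.add_right sym[of "T z" "T x - y"])
          (simp add: power2_eq_square algebra_simps)
      also have "\<dots> = F x - (b (T x - y) (T z))\<^sup>2 / b (T z) (T z)"
        using False by (simp add: t_def power2_eq_square)
      finally have "(b (T x - y) (T z))\<^sup>2 / b (T z) (T z) \<le> 0" using min[of "x + t *\<^sub>R z"] by simp
      then show ?thesis using False b_nonneg[of "T z"] by (simp add: divide_le_0_iff)
    qed
    then show ?thesis by blast
  qed
  then obtain S where S: "\<And>y z. b (T (S y) - y) (T z) = 0" by metis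
  have S_eqI: "S y = x" if "\<And>z. b (T x - y) (T z) = 0" for x y
  proof -
    have "b (T (S y - x)) (T (S y - x)) = b (T (S y) - y) (T (S y - x)) - b (T x - y) (T (S y - x))"
      by (simp add: T.diff flip: b.diff_left)
    then have "b (T (S y - x)) (T (S y - x)) = 0" by (simp add: S that)
    then show ?thesis using T_zero[of "S y - x"] by simp
  qed
  have S_le: "r\<^sup>2 * b (S y) (S y) \<le> b y y" for y
  proof -
    define v where "v = T (S y) - y"
    have "b y y = b (T (S y) - v) (T (S y) - v)" by (simp add: v_def)
    also have "\<dots> = b (T (S y)) (T (S y)) - 2 * b v (T (S y)) + b v v"
      by (simp only: b.diff_left b.diff_right sym[of "T (S y)" v])
    finally have "b (T (S y)) (T (S y)) \<le> b y y"
      using b_nonneg[of v] by (simp add: S v_def)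
    then show ?thesis using T_ge[of "S y"] by simp
  qed
  obtain K where K: "K > 0" "\<And>x y. norm (b x y) \<le> norm x * norm y * K"
    using b.pos_bounded by blast
  have S_bound: "norm (S y) \<le> norm y * (sqrt K / r)" for y
  proof -
    have "(r * norm (S y))\<^sup>2 \<le> b y y"
      using S_le[of y] mult_left_mono[OF b_ge[of "S y"], of "r\<^sup>2"] by (simp add: power_mult_distrib)
    also have "\<dots> \<le> (norm y * sqrt K)\<^sup>2"
      using K(2)[of y y] K(1) by (simp add: power_mult_distrib power2_norm_eq_inner)
        (simp add: power2_norm_eq_inner[symmetric] power2_eq_square mult_ac)
    finally have "r * norm (S y) \<le> norm y * sqrt K"
      by (rule power2_le_imp_le) (use K in auto)
    then show ?thesis using r by (simp add: field_simps)
  qed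
  have S_add: "S (y + y') = S y + S y'" for y y'
  proof (rule S_eqI)
    fix z
    have "T (S y + S y') - (y + y') = (T (S y) - y) + (T (S y') - y')" by (simp add: T.add)
    then show "b (T (S y + S y') - (y + y')) (T z) = 0" by (simp only: b.add_left S)
  qed
  have S_scaleC: "S (c *\<^sub>C y) = c *\<^sub>C S y" for c y
  proof (rule S_eqI)
    fix z
    have "b (T (c *\<^sub>C S y) - c *\<^sub>C y) (T z) = b (c *\<^sub>C (T (S y) - y)) (T z)"
      by (simp add: T_scaleC complex_vector.scale_right_diff_distrib)
    then show "b (T (c *\<^sub>C S y) - c *\<^sub>C y) (T z) = 0"
      by (simp add: b_scaleC S flip: T_scaleC)
  qed
  have "bounded_linear S"
    by (rule bounded_linear_intro[OF S_add _ S_bound]) (simp add: scaleR_scaleC S_scaleC)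
  then have "S \<in> bounded_operators"
    by (simp add: bounded_operators_iff S_scaleC)
  moreover have "S \<circ> T = id" by (auto simp: fun_eq_iff b.zero_left intro!: S_eqI)
  ultimately show ?thesis using S_le by (rule that)
qed

lemma bounded_bilinear_zero: "bounded_bilinear (\<lambda>x y. 0)"
  by unfold_locales (auto intro: exI[of _ 0])

lemma bounded_bilinear_add:
  assumes "bounded_bilinear f" "bounded_bilinear g"
  shows "bounded_bilinear (\<lambda>x y. f x y + g x y)"
proof -
  interpret f: bounded_bilinear f by fact
  interpret g: bounded_bilinear g by fact
  obtain K L where "\<And>x y. norm (f x y) \<le> norm x * norm y * K"
    "\<And>x y. norm (g x y) \<le> norm x * norm y * L"
    using f.bounded g.bounded by blast
  then have "norm (f x y + g x y) \<le> norm x * norm y * (K + L)" for x y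
    unfolding distrib_left by (meson norm_triangle_mono)
  then show ?thesis
    by unfold_locales (auto simp: f.add_left f.add_right g.add_left g.add_right f.scaleR_left
        f.scaleR_right g.scaleR_left g.scaleR_right scaleR_add_right)
qed

text \<open>
  With \<open>b x y = \<Sum>k<n. inner (T ^ k x) (T ^ k y) / r ^ (2 k)\<close>, passing from \<open>x\<close> to \<open>T x\<close> shifts the
  summation index: \<open>b (T x) (T x) / r\<^sup>2\<close> is \<open>b x x\<close> with the term \<open>(norm x)\<^sup>2\<close> exchanged for the larger
  term \<open>(norm (T ^ n x) / r ^ n)\<^sup>2\<close>. The powers of a left inverse that contracts \<open>b\<close> by \<open>r\<^sup>2\<close> have norm
  at most a constant times \<open>(1 / r) ^ k\<close>, which bounds the spectrum.
\<close>

lemma left_inverse_if_funpow_expansive: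
  fixes T :: "'a::chilbert_space \<Rightarrow> 'a"
  assumes T: "T \<in> bounded_operators" and n: "n > 0" and r: "r > 0"
    and exp: "\<And>x. r ^ n * norm x \<le> norm ((T ^^ n) x)"
  obtains S where "S \<in> bounded_operators" "S \<circ> T = id"
    "\<And>l. l \<in> spectrum S \<Longrightarrow> cmod l \<le> 1 / r"
proof -
  define b where "b x y = (\<Sum>k<n. inner ((T ^^ k) x) ((T ^^ k) y) / r ^ (2 * k))" for x y
  have P: "bounded_linear (T ^^ k)" "(T ^^ k) (c *\<^sub>C x) = c *\<^sub>C (T ^^ k) x" for k c x
    using bounded_operators_funpow[OF T] by (auto simp: bounded_operators_iff)
  have b_self: "b x x = (\<Sum>k<n. (norm ((T ^^ k) x) / r ^ k)\<^sup>2)" for x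
    unfolding b_def by (simp add: power_divide power_mult mult.commute[of 2] flip: power2_norm_eq_inner)
  have bil: "bounded_bilinear b"
  proof -
    define Q where "Q k = (\<lambda>x. (T ^^ k) x /\<^sub>R r ^ k)" for k
    have Q: "bounded_linear (Q k)" for k
      unfolding Q_def by (intro bounded_linear_const_scaleR P)
    have "b = (\<lambda>x y. \<Sum>k<n. inner (Q k x) (Q k y))"
      by (simp add: b_def Q_def fun_eq_iff divide_simps mult_2 flip: power_add)
    moreover have "bounded_bilinear (\<lambda>x y. \<Sum>k<m. inner (Q k x) (Q k y))" for m
    proof (induction m)
      case (Suc m)
      then show ?case
        using bounded_bilinear_add[OF Suc bounded_bilinear.comp[OF bounded_bilinear_inner Q Q]]
        by simp
    qed (simp add: bounded_bilinear_zero)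
    ultimately show ?thesis by simp
  qed
  have b_sym: "b x y = b y x" for x y
    by (simp add: b_def inner_commute)
  have b_scaleC: "b (c *\<^sub>C x) y = b x (cnj c *\<^sub>C y)" for c x y
    by (simp add: b_def P inner_scaleC_left)
  have b_ge: "(norm x)\<^sup>2 \<le> b x x" for x
    unfolding b_self using n member_le_sum[of 0 "{..<n}" "\<lambda>k. (norm ((T ^^ k) x) / r ^ k)\<^sup>2"] by simp
  have T_ge: "r\<^sup>2 * b x x \<le> b (T x) (T x)" for x
  proof -
    define a where "a k = (norm ((T ^^ k) x) / r ^ k)\<^sup>2" for k
    have "(norm x)\<^sup>2 \<le> a n"
      unfolding a_def using exp[of x] r by (intro power_mono) (auto simp: field_simps)
    moreover have "(\<Sum>k<n. a (Suc k)) = (\<Sum>k<n. a k) + a n - a 0"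
      using sum.lessThan_Suc_shift[of a n] by simp
    ultimately have "b x x \<le> (\<Sum>k<n. a (Suc k))"
      by (simp add: b_self a_def)
    then have "r\<^sup>2 * b x x \<le> r\<^sup>2 * (\<Sum>k<n. a (Suc k))" by (rule mult_left_mono) simp
    also have "\<dots> = b (T x) (T x)"
      using r by (simp add: b_self a_def sum_distrib_left power_divide power_mult_distrib funpow_swap1)
    finally show ?thesis .
  qed
  obtain S where S: "S \<in> bounded_operators" "S \<circ> T = id" and S_le: "\<And>y. r\<^sup>2 * b (S y) (S y) \<le> b y y"
    using contractive_left_inverse[OF T bil b_sym b_scaleC b_ge r T_ge] by metis
  obtain K where K: "K > 0" "\<And>x y. norm (b x y) \<le> norm x * norm y * K"
    using bounded_bilinear.pos_bounded[OF bil] by blast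
  have "norm ((S ^^ k) x) \<le> sqrt K * (1 / r) ^ k * norm x" for k x
  proof -
    have "(r ^ k)\<^sup>2 * b ((S ^^ k) x) ((S ^^ k) x) \<le> b x x"
    proof (induction k)
      case (Suc k)
      have "(r ^ Suc k)\<^sup>2 * b ((S ^^ Suc k) x) ((S ^^ Suc k) x)
          = (r ^ k)\<^sup>2 * (r\<^sup>2 * b (S ((S ^^ k) x)) (S ((S ^^ k) x)))"
        by (simp add: power_mult_distrib)
      also have "\<dots> \<le> (r ^ k)\<^sup>2 * b ((S ^^ k) x) ((S ^^ k) x)"
        by (intro mult_left_mono S_le) auto
      finally show ?case using Suc by simp
    qed simp
    moreover have "(r ^ k * norm ((S ^^ k) x))\<^sup>2 \<le> (r ^ k)\<^sup>2 * b ((S ^^ k) x) ((S ^^ k) x)"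
      unfolding power_mult_distrib by (intro mult_left_mono b_ge) auto
    moreover have "b x x \<le> (sqrt K * norm x)\<^sup>2"
      using K(2)[of x x] K(1) by (simp add: power_mult_distrib power2_norm_eq_inner)
        (simp add: power2_norm_eq_inner[symmetric] power2_eq_square mult_ac)
    ultimately have "(r ^ k * norm ((S ^^ k) x))\<^sup>2 \<le> (sqrt K * norm x)\<^sup>2" by linarith
    then have "r ^ k * norm ((S ^^ k) x) \<le> sqrt K * norm x"
      by (rule power2_le_imp_le) (use K in auto)
    then show ?thesis using r by (simp add: power_divide field_simps)
  qed
  from notin_spectrum_if_funpow_bound[OF S(1) this] r
  have "cmod l \<le> 1 / r" if "l \<in> spectrum S" for l
    using that by (meson less_imp_le not_le zero_less_divide_1_iff)
  with S show ?thesis by (rule that)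
qed

section \<open>The distance to the left spectrum\<close>

text \<open>
  If the left spectrum were empty, the orbits of \<open>T\<close> would grow at every rate, in particular at a rate
  above the norm of \<open>T\<close>.
\<close>

lemma left_spectrum_nonempty:
  fixes T :: "'a::complex_inner \<Rightarrow> 'a"
  assumes T: "T \<in> bounded_operators" and nontrivial: "\<exists>x::'a. x \<noteq> 0"
  shows "left_spectrum T \<noteq> {}"
proof
  assume "left_spectrum T = {}"
  then have all: "left_resolvent_set T = UNIV" by (auto simp: left_spectrum_def)
  have bl: "bounded_linear T" using T by (simp add: bounded_operators_iff)
  define r where "r = onorm T + 1"
  have r: "r > onorm T" "onorm T \<ge> 0" using onorm_pos_le[OF bl] by (auto simp: r_def)
  obtain n where n: "n > 0" "\<And>x. r ^ n * norm x \<le> norm ((T ^^ n) x)"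
    using funpow_expansive_if_cball_subset_left_resolvent_set[OF T, of r] r all
    by (metis le_less_trans subset_UNIV)
  obtain x :: 'a where "x \<noteq> 0" using nontrivial by blast
  moreover have "r ^ n * norm x \<le> onorm T ^ n * norm x"
    using n(2) funpow_le_onorm[OF bl] by (rule order_trans)
  ultimately have "r ^ n \<le> onorm T ^ n" by simp
  moreover have "onorm T ^ n < r ^ n" using r n(1) by (intro power_strict_mono) auto
  ultimately show False by simp
qed

theorem corollary2p5:
  fixes T :: "'a::chilbert_space \<Rightarrow> 'a"
  assumes "separable_space (euclidean :: 'a topology)"
    and "\<not> (\<exists>B :: 'a set. finite B \<and> complex_vector.span B = UNIV)"
    and "T \<in> bounded_operators"
    and "0 \<in> left_resolvent_set T"
  shows "(INF l \<in> left_spectrum T. ereal (cmod l)) =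
    (SUP S \<in> {S. S \<in> bounded_operators \<and> S \<circ> T = id}. 1 / ereal (spectral_radius S))"
    (is "?d = ?s")
proof -
  note T = assms(3)
  have nontrivial: "\<exists>x::'a. x \<noteq> 0"
  proof (rule ccontr)
    assume "\<nexists>x::'a. x \<noteq> 0"
    then have "complex_vector.span {} = (UNIV :: 'a set)" by auto
    with assms(2) show False by blast
  qed
  have nonzero: "l \<noteq> 0" if "l \<in> left_spectrum T" for l
    using that assms(4) by (auto simp: left_spectrum_def)
  have in_spectrum: "1 / l \<in> spectrum S"
    if "S \<in> bounded_operators" "S \<circ> T = id" "l \<in> left_spectrum T" for S l
    using inverse_in_spectrum_left_inverse[OF that nonzero[OF that(3)]] .
  have radius_ge: "1 / cmod l \<le> spectral_radius S"
    if "S \<in> bounded_operators" "S \<circ> T = id" "l \<in> left_spectrum T" for S l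
    using cSUP_upper[OF in_spectrum[OF that] bdd_above_spectrum[OF that(1)]]
    by (simp add: spectral_radius_def norm_divide)
  obtain l0 where l0: "l0 \<in> left_spectrum T"
    using left_spectrum_nonempty[OF T nontrivial] by blast
  \<comment> \<open>For an empty spectrum the supremum defining the radius would be an unspecified real number.\<close>
  have radius_pos: "0 < spectral_radius S" if "S \<in> bounded_operators" "S \<circ> T = id" for S
    using radius_ge[OF that l0] nonzero[OF l0]
    by (meson less_le_trans zero_less_divide_1_iff zero_less_norm_iff)
  have "?s \<le> ?d"
  proof (intro SUP_least INF_greatest)
    fix S l assume S: "S \<in> {S. S \<in> bounded_operators \<and> S \<circ> T = id}" and l: "l \<in> left_spectrum T"
    have "1 / cmod l \<le> spectral_radius S" using radius_ge S l by blast
    moreover have "cmod l > 0" using nonzero[OF l] by simp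
    moreover have "spectral_radius S > 0" using radius_pos S by blast
    ultimately show "1 / ereal (spectral_radius S) \<le> ereal (cmod l)"
      by (simp add: one_ereal_def field_simps del: ereal_eq_1)
  qed
  moreover have "?d \<le> ?s"
  proof (rule dense_le)
    fix e assume e: "e < ?d"
    show "e \<le> ?s"
    proof (cases "e \<le> 0")
      case True
      \<comment> \<open>Any left inverse suffices here, and one exists because \<open>0\<close> is in the left resolvent set.\<close>
      obtain L where L: "L \<in> bounded_operators" "L \<circ> (\<lambda>x. 0 *\<^sub>C x - T x) = id"
        using assms(4) by (auto simp: left_resolvent_set_def left_invertible_def)
      define S where "S = (\<lambda>x. (- 1) *\<^sub>C L x)"
      have "S \<in> bounded_operators"
        unfolding S_def by (rule bounded_operators_scaleC_comp[OF L(1)])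
      moreover have "S \<circ> T = id"
        using L by (auto simp: S_def bounded_operators_iff fun_eq_iff linear_simps
            complex_vector.scale_minus_left scaleC_one)
      ultimately have S: "S \<in> bounded_operators" "S \<circ> T = id" by blast+
      have "0 \<le> 1 / ereal (spectral_radius S)"
        using radius_pos[OF S] by (simp add: one_ereal_def less_imp_le del: ereal_eq_1)
      also have "\<dots> \<le> ?s" using S by (intro SUP_upper) auto
      finally show ?thesis using True by simp
    next
      case False
      then obtain r where r: "e = ereal r" "r > 0" using e by (cases e) auto
      have "cball 0 r \<subseteq> left_resolvent_set T"
      proof
        fix l :: complex assume l: "l \<in> cball 0 r"
        have "\<not> ?d \<le> ereal (cmod l)" using e l r by (metis ereal_less_eq(3) leD mem_cball_0 order_trans)
        then show "l \<in> left_resolvent_set T"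
          by (auto simp: left_spectrum_def intro: INF_lower)
      qed
      then obtain n where "n > 0" "\<And>x. r ^ n * norm x \<le> norm ((T ^^ n) x)"
        using funpow_expansive_if_cball_subset_left_resolvent_set[OF T r(2)] by blast
      then obtain S where S: "S \<in> bounded_operators" "S \<circ> T = id"
        and sp: "\<And>l. l \<in> spectrum S \<Longrightarrow> cmod l \<le> 1 / r"
        using left_inverse_if_funpow_expansive[OF T _ r(2)] by metis
      have "spectral_radius S \<le> 1 / r"
        unfolding spectral_radius_def using in_spectrum[OF S l0] sp by (intro cSUP_least) auto
      moreover have "spectral_radius S > 0" by (rule radius_pos[OF S])
      ultimately have "e \<le> 1 / ereal (spectral_radius S)"
        using r by (simp add: one_ereal_def field_simps del: ereal_eq_1)
      also have "\<dots> \<le> ?s" using S by (intro SUP_upper) auto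
      finally show ?thesis .
    qed
  qed
  ultimately show ?thesis by (rule antisym[rotated])
qed

end
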